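(* Fix finite nonempty sets $A$ and $\Omega$, a prior $\mu_0$ on $\Omega$ with $\mu_0(\omega)>0$ for all $\omega$, and a finite message set $M$ with $|M|>\max\{|\Omega|,|A|\}$. There is a set of environments of Lebesgue measure one in $[0,1]^{2|A||\Omega|}$ such that, for every environment in this set, the following three statements are equivalent: (i) commitment is valuable; (ii) committed Sender values randomization; (iii) for every optimal persuasion profile $(\sigma,\rho)$ there exists $m\in M_\sigma$ such that $\left|\arg\max_{a\in A}\sum_\omega \mu_m(\omega)u_R(a,\omega)\right|\ge 2$, where $\mu_m(\omega)=\frac{\mu_0(\omega)\sigma(m|\omega)}{\sum_{\omega'}\mu_0(\omega')\sigma(m|\omega')}$.
   Context: An environment is a pair $(u_S,u_R)$ of functions $A\times\Omega\to[0,1]$, identified with a point of $[0,1]^{2|A||\Omega|}$. A messaging strategy is $\sigma:\Omega\to\Delta M$ and an action strategy is $\rho:M\to\Delta A$. For $i\in\{S,R\}$, $U_i(\sigma,\rho)=\sum_{\omega,m,a}\mu_0(\omega)\sigma(m|\omega)\rho(a|m)u_i(a,\omega)$. A profile $(\sigma,\rho)$ is S-BR if $\sigma\in\arg\max_{\sigma'}U_S(\sigma',\rho)$, and R-BR if $\rho\in\arg\max_{\rho'}U_R(\sigma,\rho')$. A persuasion profile is an R-BR profile; the persuasion payoff is the maximum of $U_S$ over persuasion profiles; a persuasion profile attaining it is optimal. A cheap-talk equilibrium is an S-BR and R-BR profile; the cheap-talk payoff is the maximum of $U_S$ over cheap-talk equilibria. Commitment is valuable if the persuasion payoff strictly exceeds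 the cheap-talk payoff. $\sigma$ is partitional if for every $\omega$ some $m$ has $\sigma(m|\omega)=1$. The partitional persuasion payoff is the maximum of $U_S$ over persuasion profiles with partitional $\sigma$. Committed Sender values randomization if the persuasion payoff strictly exceeds the partitional persuasion payoff. $M_\sigma=\{m\in M:\sigma(m|\omega)>0\text{ for some }\omega\}$. *)

theory Defs
  imports "HOL-Analysis.Analysis"
begin

text \<open>States: finite type 'w; actions: finite type 'a; messages: finite type 'm.
  Utilities are functions 'a => 'w => real. A messaging strategy is
  sig :: 'w => 'm => real (sig w m = probability of message m in state w);
  an action strategy is rho :: 'm => 'a => real.\<close>

definition is_prior :: "('w::finite \<Rightarrow> real) \<Rightarrow> bool" where
  "is_prior mu0 \<longleftrightarrow> (\<forall>w. mu0 w > 0) \<and> (\<Sum>w\<in>UNIV. mu0 w) = 1"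

definition msg_strategy :: "('w::finite \<Rightarrow> 'm::finite \<Rightarrow> real) \<Rightarrow> bool" where
  "msg_strategy sig \<longleftrightarrow> (\<forall>w m. sig w m \<ge> 0) \<and> (\<forall>w. (\<Sum>m\<in>UNIV. sig w m) = 1)"

definition act_strategy :: "('m::finite \<Rightarrow> 'a::finite \<Rightarrow> real) \<Rightarrow> bool" where
  "act_strategy rho \<longleftrightarrow> (\<forall>m a. rho m a \<ge> 0) \<and> (\<forall>m. (\<Sum>a\<in>UNIV. rho m a) = 1)"

definition payoff ::
  "('w::finite \<Rightarrow> real) \<Rightarrow> ('a::finite \<Rightarrow> 'w \<Rightarrow> real) \<Rightarrow>
   ('w \<Rightarrow> 'm::finite \<Rightarrow> real) \<Rightarrow> ('m \<Rightarrow> 'a \<Rightarrow> real) \<Rightarrow> real" where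
  "payoff mu0 u sig rho =
     (\<Sum>w\<in>UNIV. \<Sum>m\<in>UNIV. \<Sum>a\<in>UNIV. mu0 w * sig w m * rho m a * u a w)"

definition S_BR where
  "S_BR mu0 uS sig rho \<longleftrightarrow> msg_strategy sig \<and>
     (\<forall>sig'. msg_strategy sig' \<longrightarrow> payoff mu0 uS sig' rho \<le> payoff mu0 uS sig rho)"

definition R_BR where
  "R_BR mu0 uR sig rho \<longleftrightarrow> act_strategy rho \<and>
     (\<forall>rho'. act_strategy rho' \<longrightarrow> payoff mu0 uR sig rho' \<le> payoff mu0 uR sig rho)"

definition persuasion_profile where
  "persuasion_profile mu0 uR sig rho \<longleftrightarrow> msg_strategy sig \<and> act_strategy rho \<and> R_BR mu0 uR sig rho"

definition cheap_talk_eq where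
  "cheap_talk_eq mu0 uS uR sig rho \<longleftrightarrow> msg_strategy sig \<and> act_strategy rho \<and>
     S_BR mu0 uS sig rho \<and> R_BR mu0 uR sig rho"

definition partitional :: "('w \<Rightarrow> 'm \<Rightarrow> real) \<Rightarrow> bool" where
  "partitional sig \<longleftrightarrow> (\<forall>w. \<exists>m. sig w m = 1)"

text \<open>The maxima below exist; we write them as suprema.\<close>
definition persuasion_payoff ::
  "('w::finite \<Rightarrow> real) \<Rightarrow> ('a::finite \<Rightarrow> 'w \<Rightarrow> real) \<Rightarrow> ('a \<Rightarrow> 'w \<Rightarrow> real) \<Rightarrow>
   'm::finite itself \<Rightarrow> real" where
  "persuasion_payoff mu0 uS uR (_::'m itself) =
     Sup {payoff mu0 uS sig rho | (sig :: 'w \<Rightarrow> 'm \<Rightarrow> real) rho. persuasion_profile mu0 uR sig rho}"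

definition partitional_persuasion_payoff ::
  "('w::finite \<Rightarrow> real) \<Rightarrow> ('a::finite \<Rightarrow> 'w \<Rightarrow> real) \<Rightarrow> ('a \<Rightarrow> 'w \<Rightarrow> real) \<Rightarrow>
   'm::finite itself \<Rightarrow> real" where
  "partitional_persuasion_payoff mu0 uS uR (_::'m itself) =
     Sup {payoff mu0 uS sig rho | (sig :: 'w \<Rightarrow> 'm \<Rightarrow> real) rho.
            persuasion_profile mu0 uR sig rho \<and> partitional sig}"

definition cheap_talk_payoff ::
  "('w::finite \<Rightarrow> real) \<Rightarrow> ('a::finite \<Rightarrow> 'w \<Rightarrow> real) \<Rightarrow> ('a \<Rightarrow> 'w \<Rightarrow> real) \<Rightarrow>
   'm::finite itself \<Rightarrow> real" where
  "cheap_talk_payoff mu0 uS uR (_::'m itself) =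
     Sup {payoff mu0 uS sig rho | (sig :: 'w \<Rightarrow> 'm \<Rightarrow> real) rho. cheap_talk_eq mu0 uS uR sig rho}"

definition optimal_persuasion_profile ::
  "('w::finite \<Rightarrow> real) \<Rightarrow> ('a::finite \<Rightarrow> 'w \<Rightarrow> real) \<Rightarrow> ('a \<Rightarrow> 'w \<Rightarrow> real) \<Rightarrow>
   ('w \<Rightarrow> 'm::finite \<Rightarrow> real) \<Rightarrow> ('m \<Rightarrow> 'a \<Rightarrow> real) \<Rightarrow> bool" where
  "optimal_persuasion_profile mu0 uS uR sig rho \<longleftrightarrow>
     persuasion_profile mu0 uR sig rho \<and>
     payoff mu0 uS sig rho = persuasion_payoff mu0 uS uR TYPE('m)"

definition commitment_valuable where
  "commitment_valuable mu0 uS uR (t::'m::finite itself) \<longleftrightarrow>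
     persuasion_payoff mu0 uS uR t > cheap_talk_payoff mu0 uS uR t"

definition values_randomization where
  "values_randomization mu0 uS uR (t::'m::finite itself) \<longleftrightarrow>
     persuasion_payoff mu0 uS uR t > partitional_persuasion_payoff mu0 uS uR t"

definition used_messages :: "('w::finite \<Rightarrow> 'm \<Rightarrow> real) \<Rightarrow> 'm set" where
  "used_messages sig = {m. \<exists>w. sig w m > 0}"

definition posterior :: "('w::finite \<Rightarrow> real) \<Rightarrow> ('w \<Rightarrow> 'm \<Rightarrow> real) \<Rightarrow> 'm \<Rightarrow> 'w \<Rightarrow> real" where
  "posterior mu0 sig m w = mu0 w * sig w m / (\<Sum>w'\<in>UNIV. mu0 w' * sig w' m)"

definition argmax_set :: "('a \<Rightarrow> real) \<Rightarrow> 'a set" where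
  "argmax_set f = {a. \<forall>a'. f a' \<le> f a}"

text \<open>An environment is a point of R^(2|A||Omega|), indexed by bool x 'a x 'w:
  index (True,a,w) is u_S(a,w) and index (False,a,w) is u_R(a,w).\<close>
definition envS :: "(bool \<times> 'a \<times> 'w \<Rightarrow> real) \<Rightarrow> 'a \<Rightarrow> 'w \<Rightarrow> real" where
  "envS e a w = e (True, a, w)"
definition envR :: "(bool \<times> 'a \<times> 'w \<Rightarrow> real) \<Rightarrow> 'a \<Rightarrow> 'w \<Rightarrow> real" where
  "envR e a w = e (False, a, w)"

definition env_cube :: "(bool \<times> 'a \<times> 'w \<Rightarrow> real) set" where
  "env_cube = {e. \<forall>i. 0 \<le> e i \<and> e i \<le> 1}"

abbreviation env_lebesgue :: "(bool \<times> 'a::finite \<times> 'w::finite \<Rightarrow> real) measure" where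
  "env_lebesgue \<equiv> PiM UNIV (\<lambda>_. lborel)"

end

theory Submission
  imports Defs
begin

text \<open>
  For almost every environment three things hold. (a) All optimal persuasion profiles induce the
  same joint distribution of actions and states: in each coordinate u_S(a, w) the persuasion payoff
  is convex with the probability of (a, w) as slope, so disagreement only occurs at kinks, and
  Fubini applies. (b) Sender is never indifferent between two actions in a known state. (c) Receiver
  is never indifferent between two actions when told only that the state lies in a given nonempty
  set.

  By (c), an optimal partitional profile has unique best responses after every used message. If an
  optimal profile has unique, hence strict, best responses, then a state preferring the action of
  another used message could shift a little mass to it without affecting Receiver, so optimality
  makes the profile a cheap-talk equilibrium. Finally, in a cheap-talk equilibrium attaining the
  persuasion payoff, Receiver does not mix after a used message: shifting mass between two actions
  in the support in either direction cannot help Sender, so it is costless and gives optimal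
  profiles with different outcomes, against (a). By (b) each state then induces a single action, and
  pooling the messages with the same response yields a partitional profile with the same payoff.
\<close>

section \<open>Compactness and null sets in product spaces\<close>

text \<open>The library's \<^emph>\<open>closed_compact_projection\<close> is restricted to Euclidean spaces.\<close>

lemma closed_projection_compact:
  fixes S :: "'a::topological_space set" and T :: "('a \<times> 'b::topological_space) set"
  assumes "compact S" "closed T"
  shows "closed {y. \<exists>x\<in>S. (x, y) \<in> T}"
proof -
  have "closed_map (top_of_set (S \<times> UNIV :: ('a \<times> 'b) set)) euclidean snd"
    using Abstract_Topological_Spaces.closed_map_snd[of "top_of_set S" "euclidean :: 'b topology"]
      assms(1) prod_topology_subtopology_eu[of S "UNIV :: 'b set"]
    by (simp add: compact_space_subtopology)
  moreover have "closedin (top_of_set (S \<times> UNIV)) (S \<times> UNIV \<inter> T)"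
    using assms(2) by (rule closedin_closed_Int)
  moreover have "snd ` (S \<times> UNIV \<inter> T) = {y. \<exists>x\<in>S. (x, y) \<in> T}"
    by force
  ultimately show ?thesis
    unfolding closed_map_def by (metis closed_closedin)
qed

lemma compact_PiE_UNIV:
  fixes K :: "'i \<Rightarrow> 'b::topological_space set"
  assumes "\<And>i. compact (K i)"
  shows "compact (Pi\<^sub>E UNIV K)"
  using compactin_PiE[of "\<lambda>_. euclidean" UNIV K] assms by (simp add: euclidean_product_topology)

lemma (in product_sigma_finite) null_sets_PiM_if_slices:
  assumes "finite I" "i \<in> I" and N: "N \<in> sets (PiM I M)"
    and slice: "\<And>x. x \<in> space (PiM (I - {i}) M) \<Longrightarrow>
      {t \<in> space (M i). x(i := t) \<in> N} \<in> null_sets (M i)"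
  shows "N \<in> null_sets (PiM I M)"
proof -
  have slice_integral: "(\<integral>\<^sup>+ t. indicator N (x(i := t)) \<partial>M i) = 0"
    if "x \<in> space (PiM (I - {i}) M)" for x
  proof -
    have "(\<integral>\<^sup>+ t. indicator N (x(i := t)) \<partial>M i)
        = (\<integral>\<^sup>+ t. indicator {t \<in> space (M i). x(i := t) \<in> N} t \<partial>M i)"
      by (intro nn_integral_cong) (simp add: indicator_def)
    then show ?thesis
      using slice[OF that] by (auto simp: null_sets_def)
  qed
  have "emeasure (PiM I M) N = (\<integral>\<^sup>+ x. indicator N x \<partial>PiM (insert i (I - {i})) M)"
    using assms(2) N by (simp add: insert_absorb)
  also have "\<dots> = (\<integral>\<^sup>+ x. (\<integral>\<^sup>+ t. indicator N (x(i := t)) \<partial>M i) \<partial>PiM (I - {i}) M)"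
    by (rule product_nn_integral_insert) (use assms(1,2) N in \<open>simp_all add: insert_absorb\<close>)
  also have "\<dots> = (\<integral>\<^sup>+ x. 0 \<partial>PiM (I - {i}) M)"
    using slice_integral by (rule nn_integral_cong)
  finally show ?thesis
    using N by (simp add: null_sets_def)
qed

lemma AE_PiM_lborel_countable_slices:
  fixes P :: "('i::finite \<Rightarrow> real) \<Rightarrow> bool" and i :: 'i
  assumes "{x. \<not> P x} \<in> sets (PiM UNIV (\<lambda>_. lborel))" "\<And>x. countable {t. \<not> P (x(i := t))}"
  shows "AE x in PiM UNIV (\<lambda>_. lborel). P x"
proof -
  interpret product_sigma_finite "\<lambda>_::'i. lborel :: real measure"
    by unfold_locales
  have "{x. \<not> P x} \<in> null_sets (PiM UNIV (\<lambda>_. lborel))"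
    by (rule null_sets_PiM_if_slices[of _ i])
      (use assms in \<open>auto intro: countable_imp_null_set_lborel\<close>)
  from AE_not_in[OF this] show ?thesis
    by simp
qed

lemma sets_PiM_lborel_eq_borel:
  "sets (PiM UNIV (\<lambda>_::'i::countable. lborel :: 'b::euclidean_space measure)) = sets borel"
  by (metis sets_PiM_cong sets_PiM_equal_borel sets_lborel)

text \<open>By monotonicity, a line parallel to the i-th axis meets the exceptional set at most once.\<close>

lemma AE_PiM_lborel_monotone_not_straddling:
  fixes F :: "('i::finite \<Rightarrow> real) \<Rightarrow> real set" and i :: 'i
  assumes measurable: "\<And>D. closed D \<Longrightarrow> {x. F x \<inter> D \<noteq> {}} \<in> sets borel"
    and mono: "\<And>x s t v v'. \<lbrakk>s < t; v \<in> F (x(i := s)); v' \<in> F (x(i := t))\<rbrakk> \<Longrightarrow> v \<le> v'"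
    and "q < r"
  shows "AE x in PiM UNIV (\<lambda>_. lborel). F x \<inter> {..q} = {} \<or> F x \<inter> {r..} = {}"
proof (rule AE_PiM_lborel_countable_slices[of _ i])
  have "{x. \<not> (F x \<inter> {..q} = {} \<or> F x \<inter> {r..} = {})} =
      {x. F x \<inter> {..q} \<noteq> {}} \<inter> {x. F x \<inter> {r..} \<noteq> {}}"
    by auto
  then show "{x. \<not> (F x \<inter> {..q} = {} \<or> F x \<inter> {r..} = {})} \<in> sets (PiM UNIV (\<lambda>_. lborel))"
    using measurable[OF closed_atMost] measurable[OF closed_atLeast]
    by (simp add: sets_PiM_lborel_eq_borel sets.Int)
next
  fix x
  let ?straddles = "\<lambda>t. F (x(i := t)) \<inter> {..q} \<noteq> {} \<and> F (x(i := t)) \<inter> {r..} \<noteq> {}"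
  have "\<not> s < t" if "?straddles s" "?straddles t" for s t
    using that mono[of s t _ x] \<open>q < r\<close> by fastforce
  then have "s = t" if "?straddles s" "?straddles t" for s t
    using that by (meson linorder_neqE)
  then have "\<exists>t. Collect ?straddles \<subseteq> {t}"
    by blast
  then have "countable (Collect ?straddles)"
    using countable_subset by fastforce
  then show "countable {t. \<not> (F (x(i := t)) \<inter> {..q} = {} \<or> F (x(i := t)) \<inter> {r..} = {})}"
    by simp
qed

lemma AE_PiM_lborel_monotone_single_valued:
  fixes F :: "('i::finite \<Rightarrow> real) \<Rightarrow> real set" and i :: 'i
  assumes "\<And>D. closed D \<Longrightarrow> {x. F x \<inter> D \<noteq> {}} \<in> sets borel"
    and "\<And>x s t v v'. \<lbrakk>s < t; v \<in> F (x(i := s)); v' \<in> F (x(i := t))\<rbrakk> \<Longrightarrow> v \<le> v'"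
  shows "AE x in PiM UNIV (\<lambda>_. lborel). \<forall>v\<in>F x. \<forall>v'\<in>F x. v = v'"
proof -
  have "AE x in PiM UNIV (\<lambda>_. lborel). \<forall>q\<in>\<rat>. \<forall>r\<in>\<rat>. q < r \<longrightarrow>
      F x \<inter> {..q} = {} \<or> F x \<inter> {r..} = {}"
    using AE_PiM_lborel_monotone_not_straddling[OF assms]
    by (auto simp: AE_ball_countable[OF countable_rat])
  then show ?thesis
  proof eventually_elim
    case (elim x)
    have "\<not> v < v'" if "v \<in> F x" "v' \<in> F x" for v v'
    proof
      assume "v < v'"
      then obtain q r where "q \<in> \<rat>" "r \<in> \<rat>" "v < q" "q < r" "r < v'"
        by (metis Rats_dense_in_real)
      then have "v \<in> F x \<inter> {..q}" "v' \<in> F x \<inter> {r..}"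
        using that by auto
      then show False
        using elim \<open>q \<in> \<rat>\<close> \<open>r \<in> \<rat>\<close> \<open>q < r\<close> by blast
    qed
    then show ?case
      by (meson linorder_neqE)
  qed
qed

section \<open>Maximizers and stochastic matrices\<close>

lemma argmax_set_nonempty:
  fixes f :: "'a::finite \<Rightarrow> real"
  shows "argmax_set f \<noteq> {}"
proof -
  have "Max (range f) \<in> range f"
    by (rule Max_in) auto
  then obtain a where "f a = Max (range f)"
    by force
  then have "a \<in> argmax_set f"
    by (simp add: argmax_set_def)
  then show ?thesis
    by blast
qed

lemma argmax_set_eq_value: "\<lbrakk>a \<in> argmax_set f; b \<in> argmax_set f\<rbrakk> \<Longrightarrow> f a = (f b :: real)"
  by (auto simp: argmax_set_def intro: antisym)

lemma card_argmax_set_ge_2_iff: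
  fixes f :: "'a::finite \<Rightarrow> real"
  shows "card (argmax_set f) \<ge> 2 \<longleftrightarrow> (\<nexists>a. argmax_set f = {a})"
proof -
  have "card (argmax_set f) \<noteq> 0"
    using argmax_set_nonempty by simp
  then have "card (argmax_set f) \<ge> 2 \<longleftrightarrow> card (argmax_set f) \<noteq> 1"
    by linarith
  then show ?thesis
    by (simp add: card_1_singleton_iff)
qed

lemma inj_imp_argmax_set_singleton:
  fixes f :: "'a::finite \<Rightarrow> real"
  assumes "inj f"
  shows "\<exists>a. argmax_set f = {a}"
proof -
  obtain a where a: "a \<in> argmax_set f"
    using argmax_set_nonempty by blast
  moreover have "b = a" if "b \<in> argmax_set f" for b
    using injD[OF assms] argmax_set_eq_value[OF that a] by blast
  ultimately show ?thesis
    by blast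
qed

lemma eventually_strict_maximizer:
  fixes f :: "'a::finite \<Rightarrow> real"
  assumes strict: "argmax_set f = {a}" and lim: "\<And>b. ((\<lambda>t. g t b) \<longlongrightarrow> f b) F"
  shows "\<forall>\<^sub>F t in F. a \<in> argmax_set (g t)"
proof -
  have "\<forall>\<^sub>F t in F. g t b \<le> g t a" for b
  proof (cases "b = a")
    case False
    have a: "f c \<le> f a" for c
      using strict by (auto simp: argmax_set_def)
    have "f b \<noteq> f a"
      using False strict a by (auto simp: argmax_set_def)
    with a have "f b < f a"
      by (simp add: order_less_le)
    then have "\<forall>\<^sub>F t in F. 0 < g t a - g t b"
      by (intro order_tendstoD(1)[OF tendsto_diff[OF lim lim]]) simp
    then show ?thesis
      by eventually_elim simp
  qed simp
  then show ?thesis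
    unfolding argmax_set_def by (simp add: eventually_all_finite)
qed

definition stochastic :: "('i \<Rightarrow> 'j::finite \<Rightarrow> real) \<Rightarrow> bool" where
  "stochastic p \<longleftrightarrow> (\<forall>i j. 0 \<le> p i j) \<and> (\<forall>i. (\<Sum>j\<in>UNIV. p i j) = 1)"

lemma stochastic_nonneg: "stochastic p \<Longrightarrow> 0 \<le> p i j"
  and stochastic_sum: "stochastic p \<Longrightarrow> (\<Sum>j\<in>UNIV. p i j) = 1"
  by (simp_all add: stochastic_def)

lemma stochastic_ex_pos: "stochastic p \<Longrightarrow> \<exists>j. p i j > 0"
  unfolding stochastic_def by (metis order_le_less sum.neutral zero_neq_one)

lemma stochastic_sum_const_on_support:
  assumes "stochastic p" "\<And>j. p i j > 0 \<Longrightarrow> v j = c"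
  shows "(\<Sum>j\<in>UNIV. p i j * v j) = c"
proof -
  have "p i j * v j = p i j * c" for j
    using assms stochastic_nonneg[OF assms(1), of i j] by (cases "p i j = 0") auto
  then have "(\<Sum>j\<in>UNIV. p i j * v j) = (\<Sum>j\<in>UNIV. p i j) * c"
    unfolding sum_distrib_right by (intro sum.cong refl)
  then show ?thesis
    using stochastic_sum[OF assms(1)] by simp
qed

lemma continuous_on_apply2:
  "continuous_on S f \<Longrightarrow> continuous_on S (\<lambda>x. f x i j)"
  by (rule continuous_on_product_then_coordinatewise[OF continuous_on_product_then_coordinatewise])

lemma closed_Collect_stochastic:
  fixes p :: "'b::topological_space \<Rightarrow> 'i \<Rightarrow> 'j::finite \<Rightarrow> real"
  assumes "continuous_on UNIV p"
  shows "closed {x. stochastic (p x)}"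
  unfolding stochastic_def
  by (intro closed_Collect_conj closed_Collect_all closed_Collect_le closed_Collect_eq
      continuous_intros continuous_on_apply2[OF assms])

lemma compact_Collect_stochastic: "compact {p :: 'i \<Rightarrow> 'j::finite \<Rightarrow> real. stochastic p}"
proof -
  have "stochastic p \<Longrightarrow> p i j \<le> 1" for p :: "'i \<Rightarrow> 'j \<Rightarrow> real" and i j
    using member_le_sum[of j UNIV "p i"] by (simp add: stochastic_def)
  then have "{p. stochastic p} =
      (\<Pi>\<^sub>E i\<in>UNIV. \<Pi>\<^sub>E j\<in>UNIV. {0..1}) \<inter> {p :: 'i \<Rightarrow> 'j \<Rightarrow> real. stochastic p}"
    by (auto simp: stochastic_nonneg)
  moreover have "compact ((\<Pi>\<^sub>E i\<in>UNIV. \<Pi>\<^sub>E j\<in>UNIV. {0..1}) \<inter>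
      {p :: 'i \<Rightarrow> 'j \<Rightarrow> real. stochastic p})"
    by (intro compact_Int_closed compact_PiE_UNIV compact_Icc closed_Collect_stochastic
        continuous_on_id)
  ultimately show ?thesis
    by simp
qed

definition pure_strategy :: "('i \<Rightarrow> 'j) \<Rightarrow> 'i \<Rightarrow> 'j \<Rightarrow> real" where
  "pure_strategy f i j = of_bool (j = f i)"

lemma stochastic_pure_strategy [simp]:
  "stochastic (pure_strategy f :: 'i \<Rightarrow> 'j::finite \<Rightarrow> real)"
  by (simp add: stochastic_def pure_strategy_def)

lemma pure_strategy_pos_iff [simp]: "pure_strategy f i j > 0 \<longleftrightarrow> j = f i"
  by (simp add: pure_strategy_def)

lemma sum_pure_strategy [simp]:
  fixes f :: "'i \<Rightarrow> 'j::finite"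
  shows "(\<Sum>j\<in>UNIV. pure_strategy f i j * v j) = v (f i)"
  by (simp add: pure_strategy_def)

lemma partitional_pure_strategy [simp]: "partitional (pure_strategy f)"
  by (simp add: partitional_def pure_strategy_def)

lemma stochastic_eq_pure_strategy:
  assumes "stochastic p" "\<And>j. p i j > 0 \<Longrightarrow> j = f i"
  shows "p i = pure_strategy f i"
proof
  fix k
  have "p i k = (\<Sum>j\<in>UNIV. p i j * of_bool (k = j))"
    by simp
  also have "\<dots> = of_bool (k = f i)"
    using assms by (intro stochastic_sum_const_on_support) auto
  finally show "p i k = pure_strategy f i k"
    by (simp add: pure_strategy_def)
qed

lemma partitional_imp_pure_strategy:
  assumes p: "stochastic p" and "partitional p"
  obtains f where "p = pure_strategy f"
proof -
  obtain f where f: "p i (f i) = 1" for i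
    using assms(2) unfolding partitional_def by metis
  have "j = f i" if "p i j > 0" for i j
  proof (rule ccontr)
    assume "j \<noteq> f i"
    then have "p i j + p i (f i) \<le> (\<Sum>j\<in>UNIV. p i j)"
      using sum_mono2[of UNIV "{j, f i}" "p i"] stochastic_nonneg[OF p] by simp
    then show False
      using that f stochastic_sum[OF p, of i] by simp
  qed
  then have "p = pure_strategy f"
    using stochastic_eq_pure_strategy[OF p] by blast
  then show ?thesis
    by (rule that)
qed

definition shift_mass :: "'i \<Rightarrow> 'j \<Rightarrow> 'j \<Rightarrow> real \<Rightarrow> ('i \<Rightarrow> 'j \<Rightarrow> real) \<Rightarrow> 'i \<Rightarrow> 'j \<Rightarrow> real" where
  "shift_mass i j k t p i' l = p i' l + of_bool (i' = i) * (t * (of_bool (l = k) - of_bool (l = j)))"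

lemma sum_shift_mass:
  fixes v :: "'j::finite \<Rightarrow> real"
  shows "(\<Sum>l\<in>UNIV. shift_mass i j k t p i' l * v l) =
    (\<Sum>l\<in>UNIV. p i' l * v l) + of_bool (i' = i) * (t * (v k - v j))"
proof -
  have "shift_mass i j k t p i' l * v l =
      p i' l * v l + of_bool (i' = i) * (t * (of_bool (l = k) * v l - of_bool (l = j) * v l))" for l
    by (simp add: shift_mass_def algebra_simps)
  then show ?thesis
    by (simp add: sum.distrib sum_subtractf flip: sum_distrib_left)
qed

lemma sum_sum_shift_mass:
  fixes v :: "'i::finite \<Rightarrow> 'j::finite \<Rightarrow> real"
  shows "(\<Sum>i'\<in>UNIV. \<Sum>l\<in>UNIV. shift_mass i j k t p i' l * v i' l) =
    (\<Sum>i'\<in>UNIV. \<Sum>l\<in>UNIV. p i' l * v i' l) + t * (v i k - v i j)"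
  by (simp add: sum_shift_mass sum.distrib)

lemma stochastic_shift_mass:
  assumes p: "stochastic p" and "0 \<le> t" "t \<le> p i j"
  shows "stochastic (shift_mass i j k t p)"
proof -
  have "0 \<le> shift_mass i j k t p i' l" for i' l
    using stochastic_nonneg[OF p] assms(2,3) by (auto simp: shift_mass_def of_bool_def)
  moreover have "(\<Sum>l\<in>UNIV. shift_mass i j k t p i' l) = 1" for i'
    using sum_shift_mass[of i j k t p i' "\<lambda>_. 1"] stochastic_sum[OF p] by simp
  ultimately show ?thesis
    by (simp add: stochastic_def)
qed

lemma stochastic_maximizer_iff:
  fixes p :: "'i::finite \<Rightarrow> 'j::finite \<Rightarrow> real"
  assumes p: "stochastic p"
  shows "(\<forall>q. stochastic q \<longrightarrow>
      (\<Sum>i\<in>UNIV. \<Sum>j\<in>UNIV. q i j * v i j) \<le> (\<Sum>i\<in>UNIV. \<Sum>j\<in>UNIV. p i j * v i j))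
    \<longleftrightarrow> (\<forall>i j. p i j > 0 \<longrightarrow> j \<in> argmax_set (v i))" (is "?max \<longleftrightarrow> ?supp")
proof
  assume max: ?max
  have "v i k \<le> v i j" if "p i j > 0" for i j k
  proof -
    have "stochastic (shift_mass i j k (p i j) p)"
      using that by (intro stochastic_shift_mass[OF p]) auto
    then have "p i j * (v i k - v i j) \<le> 0"
      using max sum_sum_shift_mass[of i j k "p i j" p v] by fastforce
    then show ?thesis
      using that by (simp add: mult_le_0_iff)
  qed
  then show ?supp
    by (simp add: argmax_set_def)
next
  assume supp: ?supp
  have "(\<Sum>j\<in>UNIV. q i j * v i j) \<le> (\<Sum>j\<in>UNIV. p i j * v i j)" if q: "stochastic q" for q i
  proof -
    obtain k where k: "k \<in> argmax_set (v i)"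
      using supp stochastic_ex_pos[OF p] by blast
    have "(\<Sum>j\<in>UNIV. q i j * v i j) \<le> (\<Sum>j\<in>UNIV. q i j * v i k)"
      using k stochastic_nonneg[OF q] by (intro sum_mono mult_left_mono) (auto simp: argmax_set_def)
    also have "\<dots> = v i k"
      using stochastic_sum[OF q] by (simp flip: sum_distrib_right)
    also have "\<dots> = (\<Sum>j\<in>UNIV. p i j * v i j)"
      using supp k
      by (intro stochastic_sum_const_on_support[OF p, symmetric] argmax_set_eq_value) auto
    finally show ?thesis .
  qed
  then show ?max
    by (simp add: sum_mono)
qed

section \<open>Payoffs and best responses\<close>

lemma msg_strategy_eq_stochastic: "msg_strategy = stochastic"
  and act_strategy_eq_stochastic: "act_strategy = stochastic"
  by (simp_all add: fun_eq_iff msg_strategy_def act_strategy_def stochastic_def)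

text \<open>Not normalised by the probability of the message, so it vanishes at unused messages.\<close>

definition act_value ::
  "('w::finite \<Rightarrow> real) \<Rightarrow> ('a \<Rightarrow> 'w \<Rightarrow> real) \<Rightarrow> ('w \<Rightarrow> 'm \<Rightarrow> real) \<Rightarrow> 'm \<Rightarrow> 'a \<Rightarrow> real" where
  "act_value mu0 u sig m a = (\<Sum>w\<in>UNIV. mu0 w * sig w m * u a w)"

definition msg_value ::
  "('a::finite \<Rightarrow> 'w \<Rightarrow> real) \<Rightarrow> ('m \<Rightarrow> 'a \<Rightarrow> real) \<Rightarrow> 'w \<Rightarrow> 'm \<Rightarrow> real" where
  "msg_value u rho w m = (\<Sum>a\<in>UNIV. rho m a * u a w)"

definition outcome ::
  "('w \<Rightarrow> real) \<Rightarrow> ('w \<Rightarrow> 'm::finite \<Rightarrow> real) \<Rightarrow> ('m \<Rightarrow> 'a \<Rightarrow> real) \<Rightarrow> 'a \<Rightarrow> 'w \<Rightarrow> real" where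
  "outcome mu0 sig rho a w = (\<Sum>m\<in>UNIV. mu0 w * sig w m * rho m a)"

lemma payoff_eq_sum_act_value:
  "payoff mu0 u sig rho = (\<Sum>m\<in>UNIV. \<Sum>a\<in>UNIV. rho m a * act_value mu0 u sig m a)"
proof -
  have "payoff mu0 u sig rho = (\<Sum>m\<in>UNIV. \<Sum>w\<in>UNIV. \<Sum>a\<in>UNIV. mu0 w * sig w m * rho m a * u a w)"
    unfolding payoff_def by (rule sum.swap)
  also have "\<dots> = (\<Sum>m\<in>UNIV. \<Sum>a\<in>UNIV. \<Sum>w\<in>UNIV. mu0 w * sig w m * rho m a * u a w)"
    by (intro sum.cong refl, rule sum.swap)
  finally show ?thesis
    by (simp add: act_value_def sum_distrib_left mult_ac)
qed

lemma payoff_eq_sum_msg_value: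
  "payoff mu0 u sig rho = (\<Sum>w\<in>UNIV. \<Sum>m\<in>UNIV. sig w m * (mu0 w * msg_value u rho w m))"
  by (simp add: payoff_def msg_value_def sum_distrib_left mult_ac)

lemma payoff_eq_sum_outcome:
  "payoff mu0 u sig rho = (\<Sum>a\<in>UNIV. \<Sum>w\<in>UNIV. outcome mu0 sig rho a w * u a w)"
proof -
  have "payoff mu0 u sig rho = (\<Sum>w\<in>UNIV. \<Sum>a\<in>UNIV. \<Sum>m\<in>UNIV. mu0 w * sig w m * rho m a * u a w)"
    unfolding payoff_def by (intro sum.cong refl, rule sum.swap)
  also have "\<dots> = (\<Sum>a\<in>UNIV. \<Sum>w\<in>UNIV. \<Sum>m\<in>UNIV. mu0 w * sig w m * rho m a * u a w)"
    by (rule sum.swap)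
  finally show ?thesis
    by (simp add: outcome_def sum_distrib_right)
qed

lemma msg_value_pure_strategy [simp]: "msg_value u (pure_strategy f) w m = u (f m) w"
  by (simp add: msg_value_def)

lemma R_BR_iff:
  assumes "stochastic rho"
  shows "R_BR mu0 uR sig rho \<longleftrightarrow> (\<forall>m a. rho m a > 0 \<longrightarrow> a \<in> argmax_set (act_value mu0 uR sig m))"
  using assms
  by (simp add: R_BR_def act_strategy_eq_stochastic payoff_eq_sum_act_value stochastic_maximizer_iff)

lemma S_BR_iff:
  assumes "is_prior mu0" "stochastic sig"
  shows "S_BR mu0 uS sig rho \<longleftrightarrow> (\<forall>w m. sig w m > 0 \<longrightarrow> m \<in> argmax_set (msg_value uS rho w))"
proof -
  have "mu0 w > 0" for w
    using assms(1) by (simp add: is_prior_def)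
  then have "argmax_set (\<lambda>m. mu0 w * msg_value uS rho w m) = argmax_set (msg_value uS rho w)" for w
    by (simp add: argmax_set_def)
  with assms(2) show ?thesis
    by (simp add: S_BR_def msg_strategy_eq_stochastic payoff_eq_sum_msg_value
        stochastic_maximizer_iff[where v = "\<lambda>w m. mu0 w * msg_value uS rho w m"])
qed

lemma persuasion_profile_iff:
  "persuasion_profile mu0 uR sig rho \<longleftrightarrow> stochastic sig \<and> stochastic rho \<and>
     (\<forall>m a. rho m a > 0 \<longrightarrow> a \<in> argmax_set (act_value mu0 uR sig m))"
  unfolding persuasion_profile_def msg_strategy_eq_stochastic act_strategy_eq_stochastic
  using R_BR_iff by blast

lemma cheap_talk_eq_iff:
  "cheap_talk_eq mu0 uS uR sig rho \<longleftrightarrow> persuasion_profile mu0 uR sig rho \<and> S_BR mu0 uS sig rho"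
  by (auto simp: cheap_talk_eq_def persuasion_profile_def)

lemma payoff_shift_message:
  "payoff mu0 u (shift_mass w m n t sig) rho =
   payoff mu0 u sig rho + t * (mu0 w * (msg_value u rho w n - msg_value u rho w m))"
  unfolding payoff_eq_sum_msg_value sum_sum_shift_mass by (simp add: right_diff_distrib)

lemma payoff_shift_action:
  "payoff mu0 u sig (shift_mass m a b t rho) =
   payoff mu0 u sig rho + t * (act_value mu0 u sig m b - act_value mu0 u sig m a)"
  unfolding payoff_eq_sum_act_value sum_sum_shift_mass ..

lemma act_value_shift_message:
  "act_value mu0 u (shift_mass w m n t sig) k a =
   act_value mu0 u sig k a + t * ((of_bool (k = n) - of_bool (k = m)) * (mu0 w * u a w))"
proof -
  have "act_value mu0 u (shift_mass w m n t sig) k a = act_value mu0 u sig k a +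
    (\<Sum>w'\<in>UNIV. of_bool (w' = w) * (t * ((of_bool (k = n) - of_bool (k = m)) * (mu0 w' * u a w'))))"
    unfolding act_value_def sum.distrib[symmetric]
    by (intro sum.cong refl) (simp add: shift_mass_def algebra_simps)
  then show ?thesis
    by simp
qed

lemma outcome_shift_action:
  assumes "a \<noteq> b"
  shows "outcome mu0 sig (shift_mass m a b t rho) a w = outcome mu0 sig rho a w - t * (mu0 w * sig w m)"
proof -
  have "mu0 w * sig w k * shift_mass m a b t rho k a =
      mu0 w * sig w k * rho k a - of_bool (k = m) * (t * (mu0 w * sig w k))" for k
    using assms by (simp add: shift_mass_def algebra_simps)
  then show ?thesis
    by (simp add: outcome_def sum_subtractf)
qed

lemma payoff_fun_upd:
  "payoff mu0 (u(a := (u a)(w := t))) sig rho =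
   payoff mu0 u sig rho + (t - u a w) * outcome mu0 sig rho a w"
proof -
  have upd: "(u(a := (u a)(w := t))) b v =
      u b v + (t - u a w) * (of_bool (b = a) * of_bool (v = w))" for b v
    by simp
  have "(\<Sum>b\<in>UNIV. \<Sum>v\<in>UNIV.
        outcome mu0 sig rho b v * ((t - u a w) * (of_bool (b = a) * of_bool (v = w))))
      = (\<Sum>b\<in>UNIV. of_bool (b = a) *
        (\<Sum>v\<in>UNIV. of_bool (v = w) * ((t - u a w) * outcome mu0 sig rho b v)))"
    unfolding sum_distrib_left by (intro sum.cong refl) simp
  also have "\<dots> = (t - u a w) * outcome mu0 sig rho a w"
    by simp
  finally show ?thesis
    unfolding payoff_eq_sum_outcome upd by (simp add: distrib_left sum.distrib)
qed

section \<open>Existence of optimal profiles\<close>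

lemma continuous_on_payoff [continuous_intros]:
  assumes "continuous_on S u" "continuous_on S sig" "continuous_on S rho"
  shows "continuous_on S (\<lambda>x. payoff mu0 (u x) (sig x) (rho x))"
  unfolding payoff_def
  by (intro continuous_intros assms[THEN continuous_on_apply2])

lemma closed_Collect_R_BR:
  fixes sig :: "'b::topological_space \<Rightarrow> 'w::finite \<Rightarrow> 'm::finite \<Rightarrow> real"
    and rho :: "'b \<Rightarrow> 'm \<Rightarrow> 'a::finite \<Rightarrow> real"
  assumes "continuous_on UNIV uR" "continuous_on UNIV sig" "continuous_on UNIV rho"
  shows "closed {x. R_BR mu0 (uR x) (sig x) (rho x)}"
  unfolding R_BR_def act_strategy_eq_stochastic
  by (intro closed_Collect_conj closed_Collect_all closed_Collect_imp closed_Collect_le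
      closed_Collect_stochastic open_Collect_const continuous_intros assms)

lemma closed_Collect_S_BR:
  fixes sig :: "'b::topological_space \<Rightarrow> 'w::finite \<Rightarrow> 'm::finite \<Rightarrow> real"
    and rho :: "'b \<Rightarrow> 'm \<Rightarrow> 'a::finite \<Rightarrow> real"
  assumes "continuous_on UNIV uS" "continuous_on UNIV sig" "continuous_on UNIV rho"
  shows "closed {x. S_BR mu0 (uS x) (sig x) (rho x)}"
  unfolding S_BR_def msg_strategy_eq_stochastic
  by (intro closed_Collect_conj closed_Collect_all closed_Collect_imp closed_Collect_le
      closed_Collect_stochastic open_Collect_const continuous_intros assms)

lemma closed_Collect_persuasion_profile:
  fixes sig :: "'b::topological_space \<Rightarrow> 'w::finite \<Rightarrow> 'm::finite \<Rightarrow> real"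
    and rho :: "'b \<Rightarrow> 'm \<Rightarrow> 'a::finite \<Rightarrow> real"
  assumes "continuous_on UNIV uR" "continuous_on UNIV sig" "continuous_on UNIV rho"
  shows "closed {x. persuasion_profile mu0 (uR x) (sig x) (rho x)}"
  unfolding persuasion_profile_def msg_strategy_eq_stochastic act_strategy_eq_stochastic
  by (intro closed_Collect_conj closed_Collect_stochastic closed_Collect_R_BR assms)

lemma closed_Collect_partitional:
  fixes sig :: "'b::topological_space \<Rightarrow> 'w::finite \<Rightarrow> 'm::finite \<Rightarrow> real"
  assumes "continuous_on UNIV sig"
  shows "closed {x. partitional (sig x)}"
proof -
  have "{x. partitional (sig x)} = (\<Inter>w. \<Union>m. {x. sig x w m = 1})"
    by (auto simp: partitional_def)
  moreover have "closed {x. sig x w m = 1}" for w m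
    by (intro closed_Collect_eq continuous_intros continuous_on_apply2[OF assms])
  ultimately show ?thesis
    by (auto intro!: closed_INT closed_UN)
qed

lemma compact_payoff_image:
  assumes "compact C"
  shows "compact ((\<lambda>z. payoff mu0 u (fst z) (snd z)) ` C)"
  using assms by (intro compact_continuous_image continuous_intros)

lemma compact_strategy_profiles:
  "compact ({sig :: 'w \<Rightarrow> 'm::finite \<Rightarrow> real. stochastic sig} \<times>
     {rho :: 'm \<Rightarrow> 'a::finite \<Rightarrow> real. stochastic rho})"
  by (intro compact_Times compact_Collect_stochastic)

lemma Collect_payoff_eq_image:
  "{payoff mu0 u sig rho | sig rho. P sig rho} =
   (\<lambda>z. payoff mu0 u (fst z) (snd z)) ` {z. P (fst z) (snd z)}"
  by (simp add: image_def conj_commute)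

lemma payoff_le_Sup:
  fixes P :: "('w::finite \<Rightarrow> 'm::finite \<Rightarrow> real) \<Rightarrow> ('m \<Rightarrow> 'a::finite \<Rightarrow> real) \<Rightarrow> bool"
  assumes "P sig rho" and strat: "\<And>sig rho. P sig rho \<Longrightarrow> stochastic sig \<and> stochastic rho"
  shows "payoff mu0 u sig rho \<le> Sup {payoff mu0 u sig rho | sig rho. P sig rho}"
proof (rule cSup_upper)
  have "{payoff mu0 u sig rho | sig rho. P sig rho} \<subseteq>
      (\<lambda>z. payoff mu0 u (fst z) (snd z)) `
        ({sig :: 'w \<Rightarrow> 'm \<Rightarrow> real. stochastic sig} \<times> {rho. stochastic rho})"
    unfolding Collect_payoff_eq_image using strat by (intro image_mono) auto
  then show "bdd_above {payoff mu0 u sig rho | sig rho. P sig rho}"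
    by (rule bdd_above_mono[rotated])
      (intro bounded_imp_bdd_above compact_imp_bounded compact_payoff_image compact_strategy_profiles)
qed (use assms(1) in blast)

lemma payoff_attains_Sup:
  assumes "P sig0 rho0" "closed {z. P (fst z) (snd z)}"
    and strat: "\<And>sig rho. P sig rho \<Longrightarrow> stochastic sig \<and> stochastic rho"
  obtains sig rho where "P sig rho"
    "payoff mu0 u sig rho = Sup {payoff mu0 u sig rho | sig rho. P sig rho}"
proof -
  let ?V = "{payoff mu0 u sig rho | sig rho. P sig rho}"
  have "{z. P (fst z) (snd z)} =
      ({sig. stochastic sig} \<times> {rho. stochastic rho}) \<inter> {z. P (fst z) (snd z)}"
    using strat by auto
  then have "compact {z. P (fst z) (snd z)}"
    using compact_Int_closed[OF compact_strategy_profiles assms(2)] by simp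
  then have "compact ?V"
    unfolding Collect_payoff_eq_image by (rule compact_payoff_image)
  moreover have "?V \<noteq> {}"
    using assms(1) by blast
  ultimately have "Sup ?V \<in> ?V"
    by (intro closed_contains_Sup bounded_imp_bdd_above compact_imp_bounded compact_imp_closed)
  then show ?thesis
    using that by auto
qed

lemma babbling_equilibrium:
  assumes "is_prior (mu0 :: 'w::finite \<Rightarrow> real)"
  obtains m :: "'m::finite" and a :: "'a::finite"
  where "cheap_talk_eq mu0 uS uR (pure_strategy (\<lambda>_. m)) (pure_strategy (\<lambda>_. a))"
proof -
  fix m :: 'm
  define sig :: "'w \<Rightarrow> 'm \<Rightarrow> real" where "sig = pure_strategy (\<lambda>_. m)"
  obtain a where a: "a \<in> argmax_set (act_value mu0 uR sig m)"
    using argmax_set_nonempty by blast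
  have "a \<in> argmax_set (act_value mu0 uR sig k)" for k
    using a by (cases "k = m") (simp_all add: argmax_set_def act_value_def sig_def pure_strategy_def)
  then have "persuasion_profile mu0 uR sig (pure_strategy (\<lambda>_. a))"
    by (simp add: persuasion_profile_iff sig_def)
  moreover have "S_BR mu0 uS sig (pure_strategy (\<lambda>_. a))"
    using assms by (simp add: S_BR_iff sig_def argmax_set_def)
  ultimately have "cheap_talk_eq mu0 uS uR sig (pure_strategy (\<lambda>_. a))"
    by (simp add: cheap_talk_eq_iff)
  then show ?thesis
    using that by (simp add: sig_def)
qed

lemma payoff_le_persuasion_payoff:
  fixes sig :: "'w::finite \<Rightarrow> 'm::finite \<Rightarrow> real"
  assumes "persuasion_profile mu0 uR sig rho"
  shows "payoff mu0 uS sig rho \<le> persuasion_payoff mu0 uS uR TYPE('m)"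
  unfolding persuasion_payoff_def
  using assms by (rule payoff_le_Sup) (simp add: persuasion_profile_iff)

lemma payoff_le_partitional_persuasion_payoff:
  fixes sig :: "'w::finite \<Rightarrow> 'm::finite \<Rightarrow> real"
  assumes "persuasion_profile mu0 uR sig rho" "partitional sig"
  shows "payoff mu0 uS sig rho \<le> partitional_persuasion_payoff mu0 uS uR TYPE('m)"
  unfolding partitional_persuasion_payoff_def
  using assms by (intro payoff_le_Sup) (auto simp: persuasion_profile_iff)

lemma payoff_le_cheap_talk_payoff:
  fixes sig :: "'w::finite \<Rightarrow> 'm::finite \<Rightarrow> real"
  assumes "cheap_talk_eq mu0 uS uR sig rho"
  shows "payoff mu0 uS sig rho \<le> cheap_talk_payoff mu0 uS uR TYPE('m)"
  unfolding cheap_talk_payoff_def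
  using assms by (rule payoff_le_Sup) (simp add: cheap_talk_eq_iff persuasion_profile_iff)

lemma optimal_persuasion_profile_iff:
  fixes sig :: "'w::finite \<Rightarrow> 'm::finite \<Rightarrow> real"
  shows "optimal_persuasion_profile mu0 uS uR sig rho \<longleftrightarrow> persuasion_profile mu0 uR sig rho \<and>
    persuasion_payoff mu0 uS uR TYPE('m) \<le> payoff mu0 uS sig rho"
  using payoff_le_persuasion_payoff[of mu0 uR sig rho uS] by (auto simp: optimal_persuasion_profile_def)

lemma optimal_persuasion_profile_exists:
  assumes "is_prior mu0"
  obtains sig :: "'w::finite \<Rightarrow> 'm::finite \<Rightarrow> real" and rho
  where "optimal_persuasion_profile mu0 uS uR sig rho"
proof -
  obtain m :: 'm and a where
    "persuasion_profile mu0 uR (pure_strategy (\<lambda>_. m)) (pure_strategy (\<lambda>_. a))"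
    using babbling_equilibrium[OF assms] unfolding cheap_talk_eq_iff by metis
  moreover have "closed {z :: ('w \<Rightarrow> 'm \<Rightarrow> real) \<times> _. persuasion_profile mu0 uR (fst z) (snd z)}"
    by (intro closed_Collect_persuasion_profile continuous_intros)
  ultimately obtain sig :: "'w \<Rightarrow> 'm \<Rightarrow> real" and rho where
    "persuasion_profile mu0 uR sig rho" "payoff mu0 uS sig rho = persuasion_payoff mu0 uS uR TYPE('m)"
    unfolding persuasion_payoff_def
    by (rule payoff_attains_Sup) (auto simp: persuasion_profile_iff)
  then show ?thesis
    using that by (simp add: optimal_persuasion_profile_def)
qed

lemma partitional_persuasion_payoff_attained:
  assumes "is_prior mu0"
  obtains sig :: "'w::finite \<Rightarrow> 'm::finite \<Rightarrow> real" and rho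
  where "persuasion_profile mu0 uR sig rho" "partitional sig"
    "payoff mu0 uS sig rho = partitional_persuasion_payoff mu0 uS uR TYPE('m)"
proof -
  let ?P = "\<lambda>(sig :: 'w \<Rightarrow> 'm \<Rightarrow> real) rho. persuasion_profile mu0 uR sig rho \<and> partitional sig"
  obtain m and a where "?P (pure_strategy (\<lambda>_. m)) (pure_strategy (\<lambda>_. a))"
    using babbling_equilibrium[OF assms] partitional_pure_strategy unfolding cheap_talk_eq_iff by metis
  moreover have "closed {z. ?P (fst z) (snd z)}"
    by (intro closed_Collect_conj closed_Collect_persuasion_profile closed_Collect_partitional
        continuous_intros)
  ultimately obtain sig :: "'w \<Rightarrow> 'm \<Rightarrow> real" and rho where
    "?P sig rho" "payoff mu0 uS sig rho = partitional_persuasion_payoff mu0 uS uR TYPE('m)"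
    unfolding partitional_persuasion_payoff_def
    by (rule payoff_attains_Sup[of ?P]) (auto simp: persuasion_profile_iff)
  then show ?thesis
    using that by blast
qed

lemma cheap_talk_payoff_attained:
  assumes "is_prior mu0"
  obtains sig :: "'w::finite \<Rightarrow> 'm::finite \<Rightarrow> real" and rho
  where "cheap_talk_eq mu0 uS uR sig rho"
    "payoff mu0 uS sig rho = cheap_talk_payoff mu0 uS uR TYPE('m)"
proof -
  obtain m :: 'm and a where
    "cheap_talk_eq mu0 uS uR (pure_strategy (\<lambda>_. m)) (pure_strategy (\<lambda>_. a))"
    using babbling_equilibrium[OF assms] .
  moreover have "closed {z :: ('w \<Rightarrow> 'm \<Rightarrow> real) \<times> _. cheap_talk_eq mu0 uS uR (fst z) (snd z)}"
    unfolding cheap_talk_eq_iff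
    by (intro closed_Collect_conj closed_Collect_persuasion_profile closed_Collect_S_BR
        continuous_intros)
  ultimately obtain sig :: "'w \<Rightarrow> 'm \<Rightarrow> real" and rho where
    "cheap_talk_eq mu0 uS uR sig rho"
    "payoff mu0 uS sig rho = cheap_talk_payoff mu0 uS uR TYPE('m)"
    unfolding cheap_talk_payoff_def
    by (rule payoff_attains_Sup) (auto simp: cheap_talk_eq_iff persuasion_profile_iff)
  then show ?thesis
    by (rule that)
qed

section \<open>Unique best responses and cheap talk\<close>

definition unique_best_responses ::
  "('w::finite \<Rightarrow> real) \<Rightarrow> ('a::finite \<Rightarrow> 'w \<Rightarrow> real) \<Rightarrow> ('w \<Rightarrow> 'm \<Rightarrow> real) \<Rightarrow> bool" where
  "unique_best_responses mu0 uR sig \<longleftrightarrow>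
     (\<forall>m\<in>used_messages sig. \<exists>a. argmax_set (act_value mu0 uR sig m) = {a})"

definition never_indifferent :: "('w \<Rightarrow> real) \<Rightarrow> ('a \<Rightarrow> 'w \<Rightarrow> real) \<Rightarrow> bool" where
  "never_indifferent mu0 u \<longleftrightarrow>
     (\<forall>T a b. T \<noteq> {} \<longrightarrow> a \<noteq> b \<longrightarrow> (\<Sum>w\<in>T. mu0 w * u a w) \<noteq> (\<Sum>w\<in>T. mu0 w * u b w))"

lemma stochastic_unused_message: "\<lbrakk>stochastic sig; m \<notin> used_messages sig\<rbrakk> \<Longrightarrow> sig w m = 0"
  by (metis (mono_tags, lifting) mem_Collect_eq order_le_less stochastic_nonneg used_messages_def)

lemma act_value_unused_message:
  "\<lbrakk>stochastic sig; m \<notin> used_messages sig\<rbrakk> \<Longrightarrow> act_value mu0 u sig m a = 0"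
  by (simp add: act_value_def stochastic_unused_message)

lemma used_message_exists:
  assumes "stochastic sig"
  obtains m where "m \<in> used_messages sig"
  using stochastic_ex_pos[OF assms] unfolding used_messages_def by blast

lemma payoff_cong_used_messages:
  assumes "stochastic sig" "\<And>m. m \<in> used_messages sig \<Longrightarrow> rho m = rho' m"
  shows "payoff mu0 u sig rho = payoff mu0 u sig rho'"
  unfolding payoff_def
proof (intro sum.cong refl)
  fix w m a
  show "mu0 w * sig w m * rho m a * u a w = mu0 w * sig w m * rho' m a * u a w"
    using assms stochastic_unused_message[of sig m w] by (cases "m \<in> used_messages sig") auto
qed

lemma argmax_posterior_eq_argmax_act_value:
  assumes "is_prior mu0" "stochastic sig" "m \<in> used_messages sig"
  shows "argmax_set (\<lambda>a. \<Sum>w\<in>UNIV. posterior mu0 sig m w * u a w) =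
    argmax_set (act_value mu0 u sig m)"
proof -
  obtain w where "sig w m > 0"
    using assms(3) by (auto simp: used_messages_def)
  then have "(\<Sum>w\<in>UNIV. mu0 w * sig w m) > 0"
    using assms(1,2) by (intro sum_pos2[where i = w])
      (auto simp: is_prior_def stochastic_nonneg less_imp_le)
  moreover have "(\<Sum>w\<in>UNIV. posterior mu0 sig m w * u a w)
      = act_value mu0 u sig m a / (\<Sum>w\<in>UNIV. mu0 w * sig w m)" for a
    by (simp add: posterior_def act_value_def sum_divide_distrib)
  ultimately show ?thesis
    by (simp add: argmax_set_def divide_le_cancel)
qed

lemma unique_best_responses_iff_card_argmax_posterior:
  assumes "is_prior mu0" "stochastic sig"
  shows "unique_best_responses mu0 uR sig \<longleftrightarrow> \<not> (\<exists>m\<in>used_messages sig.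
    card (argmax_set (\<lambda>a. \<Sum>w\<in>UNIV. posterior mu0 sig m w * uR a w)) \<ge> 2)"
  unfolding unique_best_responses_def card_argmax_set_ge_2_iff
  using argmax_posterior_eq_argmax_act_value[OF assms, of _ uR] by simp

lemma partitional_imp_unique_best_responses:
  assumes "never_indifferent mu0 uR" "stochastic sig" "partitional sig"
  shows "unique_best_responses mu0 uR sig"
  unfolding unique_best_responses_def
proof
  fix m assume "m \<in> used_messages sig"
  obtain f where f: "sig = pure_strategy f"
    using partitional_imp_pure_strategy[OF assms(2,3)] .
  have "{w. f w = m} \<noteq> {}"
    using \<open>m \<in> used_messages sig\<close> by (auto simp: f used_messages_def)
  moreover have "act_value mu0 uR sig m a = (\<Sum>w | f w = m. mu0 w * uR a w)" for a
    unfolding act_value_def f pure_strategy_def by (rule sum.mono_neutral_cong_right) auto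
  ultimately have "act_value mu0 uR sig m a \<noteq> act_value mu0 uR sig m b" if "a \<noteq> b" for a b
    using assms(1) that by (simp add: never_indifferent_def)
  then have "inj (act_value mu0 uR sig m)"
    by (auto simp: inj_def)
  then show "\<exists>a. argmax_set (act_value mu0 uR sig m) = {a}"
    by (rule inj_imp_argmax_set_singleton)
qed

lemma unique_best_responses_imp_pure_response:
  assumes opt: "optimal_persuasion_profile mu0 uS uR sig rho"
    and uniq: "unique_best_responses mu0 uR sig"
  obtains f where "optimal_persuasion_profile mu0 uS uR sig (pure_strategy f)"
    "range f = f ` used_messages sig"
proof -
  have sig: "stochastic sig" and rho: "stochastic rho"
    and br: "\<And>m a. rho m a > 0 \<Longrightarrow> a \<in> argmax_set (act_value mu0 uR sig m)"
    using opt by (auto simp: optimal_persuasion_profile_def persuasion_profile_iff)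
  obtain g where g: "\<And>m. m \<in> used_messages sig \<Longrightarrow> argmax_set (act_value mu0 uR sig m) = {g m}"
    using uniq unfolding unique_best_responses_def by metis
  obtain m0 where m0: "m0 \<in> used_messages sig"
    using used_message_exists[OF sig] .
  define f where "f m = (if m \<in> used_messages sig then g m else g m0)" for m
  have "f m \<in> argmax_set (act_value mu0 uR sig m)" for m
    using g act_value_unused_message[OF sig, of m mu0 uR]
    by (cases "m \<in> used_messages sig") (auto simp: f_def argmax_set_def)
  moreover have "payoff mu0 uS sig rho = payoff mu0 uS sig (pure_strategy f)"
  proof (rule payoff_cong_used_messages[OF sig])
    fix m assume "m \<in> used_messages sig"
    then show "rho m = pure_strategy f m"
      using br g by (intro stochastic_eq_pure_strategy[OF rho]) (auto simp: f_def)
  qed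
  ultimately have "optimal_persuasion_profile mu0 uS uR sig (pure_strategy f)"
    using opt sig by (simp add: optimal_persuasion_profile_def persuasion_profile_iff)
  moreover have "range f = f ` used_messages sig"
    using m0 by (auto simp: f_def)
  ultimately show ?thesis
    by (rule that)
qed

lemma eventually_persuasion_profile_shift_message:
  assumes prof: "persuasion_profile mu0 uR sig (pure_strategy f)"
    and uniq: "unique_best_responses mu0 uR sig"
    and pos: "sig w m > 0" and n: "n \<in> used_messages sig"
  shows "\<forall>\<^sub>F t in at_right 0. persuasion_profile mu0 uR (shift_mass w m n t sig) (pure_strategy f)"
proof -
  have sig: "stochastic sig" and br: "\<And>k. f k \<in> argmax_set (act_value mu0 uR sig k)"
    using prof by (auto simp: persuasion_profile_iff)
  have "\<forall>\<^sub>F t in at_right 0. f k \<in> argmax_set (act_value mu0 uR (shift_mass w m n t sig) k)" for k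
  proof (cases "k \<in> used_messages sig")
    case True
    then have strict: "argmax_set (act_value mu0 uR sig k) = {f k}"
      using uniq br[of k] unfolding unique_best_responses_def by fastforce
    have "((\<lambda>t. act_value mu0 uR (shift_mass w m n t sig) k b) \<longlongrightarrow> act_value mu0 uR sig k b)
      (at_right 0)" for b
      unfolding act_value_shift_message by (rule tendsto_eq_intros refl | simp)+
    then show ?thesis
      by (rule eventually_strict_maximizer[OF strict])
  next
    case False
    then have "k \<noteq> m" "k \<noteq> n"
      using pos n by (auto simp: used_messages_def)
    then show ?thesis
      using act_value_unused_message[OF sig False, of mu0 uR]
      by (simp add: argmax_set_def act_value_shift_message)
  qed
  then have "\<forall>\<^sub>F t in at_right 0.
      \<forall>k. f k \<in> argmax_set (act_value mu0 uR (shift_mass w m n t sig) k)"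
    by (rule eventually_all_finite)
  moreover have "\<forall>\<^sub>F t in at_right 0. t < sig w m"
    using pos by (rule eventually_at_rightI[of 0 _ _, rotated]) auto
  moreover have "\<forall>\<^sub>F t in at_right 0. (0::real) < t"
    by (rule eventually_at_right_less)
  ultimately show ?thesis
    by eventually_elim (simp add: persuasion_profile_iff stochastic_shift_mass[OF sig])
qed

lemma unique_best_responses_imp_S_BR:
  assumes prior: "is_prior mu0"
    and opt: "optimal_persuasion_profile mu0 uS uR sig (pure_strategy f)"
    and uniq: "unique_best_responses mu0 uR sig" and range: "range f = f ` used_messages sig"
  shows "S_BR mu0 uS sig (pure_strategy f)"
proof -
  have prof: "persuasion_profile mu0 uR sig (pure_strategy f)"
    using opt by (simp add: optimal_persuasion_profile_def)
  have "uS (f m') w \<le> uS (f m) w" if pos: "sig w m > 0" for w m m'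
  proof -
    obtain n where n: "n \<in> used_messages sig" "f n = f m'"
      using range by (metis imageE rangeI)
    have "\<forall>\<^sub>F t in at_right 0.
        persuasion_profile mu0 uR (shift_mass w m n t sig) (pure_strategy f) \<and> 0 < t"
      by (intro eventually_conj eventually_at_right_less
          eventually_persuasion_profile_shift_message[OF prof uniq pos n(1)])
    then obtain t where "t > 0"
      and "persuasion_profile mu0 uR (shift_mass w m n t sig) (pure_strategy f)"
      using eventually_happens'[OF trivial_limit_at_right_real] by blast
    then have "payoff mu0 uS (shift_mass w m n t sig) (pure_strategy f) \<le>
        payoff mu0 uS sig (pure_strategy f)"
      using opt payoff_le_persuasion_payoff by (metis optimal_persuasion_profile_def)
    then have "t * (mu0 w * (uS (f n) w - uS (f m) w)) \<le> 0"
      by (simp add: payoff_shift_message)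
    moreover have "mu0 w > 0"
      using prior by (simp add: is_prior_def)
    ultimately show ?thesis
      using \<open>t > 0\<close> n(2) by (simp add: mult_le_0_iff)
  qed
  then show ?thesis
    using prof by (simp add: S_BR_iff[OF prior] persuasion_profile_iff argmax_set_def)
qed

lemma unique_best_responses_imp_not_commitment_valuable:
  fixes sig :: "'w::finite \<Rightarrow> 'm::finite \<Rightarrow> real"
  assumes prior: "is_prior mu0"
    and opt: "optimal_persuasion_profile mu0 uS uR sig rho"
    and uniq: "unique_best_responses mu0 uR sig"
  shows "\<not> commitment_valuable mu0 uS uR TYPE('m)"
proof -
  obtain f where f: "optimal_persuasion_profile mu0 uS uR sig (pure_strategy f)"
    "range f = f ` used_messages sig"
    using unique_best_responses_imp_pure_response[OF opt uniq] .
  have "cheap_talk_eq mu0 uS uR sig (pure_strategy f)"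
    using unique_best_responses_imp_S_BR[OF prior f(1) uniq f(2)] f(1)
    by (simp add: cheap_talk_eq_iff optimal_persuasion_profile_def)
  then have "payoff mu0 uS sig (pure_strategy f) \<le> cheap_talk_payoff mu0 uS uR TYPE('m)"
    by (rule payoff_le_cheap_talk_payoff)
  then show ?thesis
    using f(1) by (simp add: commitment_valuable_def optimal_persuasion_profile_def not_less)
qed

section \<open>Pure responses and pooling\<close>

definition unique_optimal_outcome ::
  "('w::finite \<Rightarrow> real) \<Rightarrow> ('a::finite \<Rightarrow> 'w \<Rightarrow> real) \<Rightarrow> ('a \<Rightarrow> 'w \<Rightarrow> real) \<Rightarrow> 'm::finite itself \<Rightarrow> bool"
where
  "unique_optimal_outcome mu0 uS uR (_::'m itself) \<longleftrightarrow>
     (\<forall>(sig1 :: 'w \<Rightarrow> 'm \<Rightarrow> real) rho1 (sig2 :: 'w \<Rightarrow> 'm \<Rightarrow> real) rho2.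
        optimal_persuasion_profile mu0 uS uR sig1 rho1 \<longrightarrow>
        optimal_persuasion_profile mu0 uS uR sig2 rho2 \<longrightarrow>
        outcome mu0 sig1 rho1 = outcome mu0 sig2 rho2)"

lemma persuasion_profile_shift_action:
  assumes prof: "persuasion_profile mu0 uR sig rho" and pos: "rho m a > 0" "rho m b > 0"
  shows "persuasion_profile mu0 uR sig (shift_mass m a b (rho m a) rho)"
proof -
  have "rho k c > 0" if "shift_mass m a b (rho m a) rho k c > 0" for k c
    using that pos by (auto simp: shift_mass_def of_bool_def split: if_splits)
  moreover have "stochastic (shift_mass m a b (rho m a) rho)"
    using prof pos by (intro stochastic_shift_mass) (auto simp: persuasion_profile_iff)
  ultimately show ?thesis
    using prof by (simp add: persuasion_profile_iff)
qed

lemma optimal_imp_pure_response: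
  fixes sig :: "'w::finite \<Rightarrow> 'm::finite \<Rightarrow> real"
  assumes prior: "is_prior mu0"
    and unique: "unique_optimal_outcome mu0 uS uR TYPE('m)"
    and opt: "optimal_persuasion_profile mu0 uS uR sig rho"
    and used: "m \<in> used_messages sig" and pos: "rho m a > 0" "rho m b > 0"
  shows "a = b"
proof (rule ccontr)
  assume "a \<noteq> b"
  have prof: "persuasion_profile mu0 uR sig rho"
    using opt by (simp add: optimal_persuasion_profile_def)
  note shift = persuasion_profile_shift_action[OF prof]
  have Sender_le: "act_value mu0 uS sig m d \<le> act_value mu0 uS sig m c"
    if "rho m c > 0" "rho m d > 0" for c d
    using payoff_le_persuasion_payoff[OF shift[OF that], of uS] opt that(1)
    by (simp add: optimal_persuasion_profile_def payoff_shift_action mult_le_0_iff)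
  have "act_value mu0 uS sig m a = act_value mu0 uS sig m b"
    using Sender_le pos by (intro antisym)
  then have "optimal_persuasion_profile mu0 uS uR sig (shift_mass m a b (rho m a) rho)"
    using opt shift[OF pos] by (simp add: optimal_persuasion_profile_def payoff_shift_action)
  then have "outcome mu0 sig (shift_mass m a b (rho m a) rho) = outcome mu0 sig rho"
    using unique opt unfolding unique_optimal_outcome_def by blast
  moreover obtain w where "sig w m > 0"
    using used by (auto simp: used_messages_def)
  ultimately have "rho m a * (mu0 w * sig w m) = 0"
    using outcome_shift_action[OF \<open>a \<noteq> b\<close>, of mu0 sig m "rho m a" rho w] by simp
  then show False
    using pos(1) \<open>sig w m > 0\<close> prior by (auto simp: is_prior_def less_le)
qed

definition pool_messages :: "('m::finite \<Rightarrow> 'n) \<Rightarrow> ('w \<Rightarrow> 'm \<Rightarrow> real) \<Rightarrow> 'w \<Rightarrow> 'n \<Rightarrow> real" where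
  "pool_messages h sig w n = (\<Sum>m | h m = n. sig w m)"

lemma sum_pool_messages:
  fixes h :: "'m::finite \<Rightarrow> 'n::finite" and v :: "'n \<Rightarrow> real"
  shows "(\<Sum>n\<in>UNIV. pool_messages h sig w n * v n) = (\<Sum>m\<in>UNIV. sig w m * v (h m))"
proof -
  have "(\<Sum>n\<in>UNIV. pool_messages h sig w n * v n) =
      (\<Sum>n\<in>UNIV. \<Sum>m | m \<in> UNIV \<and> h m = n. sig w m * v (h m))"
    by (simp add: pool_messages_def sum_distrib_right)
  also have "\<dots> = (\<Sum>m\<in>UNIV. sig w m * v (h m))"
    by (rule sum.group) auto
  finally show ?thesis .
qed

lemma stochastic_pool_messages:
  fixes h :: "'m::finite \<Rightarrow> 'n::finite"
  assumes "stochastic sig"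
  shows "stochastic (pool_messages h sig)"
  using assms sum_pool_messages[of h sig _ "\<lambda>_. 1"]
  by (auto simp: stochastic_def pool_messages_def intro: sum_nonneg)

lemma payoff_pool_messages:
  fixes h :: "'m::finite \<Rightarrow> 'n::finite"
  shows "payoff mu0 u (pool_messages h sig) rho = payoff mu0 u sig (rho \<circ> h)"
  by (simp add: payoff_eq_sum_msg_value sum_pool_messages msg_value_def)

lemma act_value_pool_messages:
  "act_value mu0 u (pool_messages h sig) n a = (\<Sum>m | h m = n. act_value mu0 u sig m a)"
  unfolding act_value_def pool_messages_def
  by (simp add: sum_distrib_left sum_distrib_right sum.swap[of _ _ UNIV])

lemma persuasion_profile_pool_messages:
  fixes h :: "'m::finite \<Rightarrow> 'm"
  assumes "persuasion_profile mu0 uR sig rho" "rho \<circ> h = rho"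
  shows "persuasion_profile mu0 uR (pool_messages h sig) rho"
proof -
  have sig: "stochastic sig" and rho: "stochastic rho"
    and br: "\<And>m a. rho m a > 0 \<Longrightarrow> a \<in> argmax_set (act_value mu0 uR sig m)"
    using assms(1) by (auto simp: persuasion_profile_iff)
  have "act_value mu0 uR (pool_messages h sig) n b \<le> act_value mu0 uR (pool_messages h sig) n a"
    if "rho n a > 0" for n a b
    unfolding act_value_pool_messages
  proof (rule sum_mono)
    fix m assume "m \<in> {m. h m = n}"
    then have "rho m a > 0"
      using that fun_cong[OF assms(2), of m] by simp
    then show "act_value mu0 uR sig m b \<le> act_value mu0 uR sig m a"
      using br by (simp add: argmax_set_def)
  qed
  then show ?thesis
    using rho stochastic_pool_messages[OF sig] by (simp add: persuasion_profile_iff argmax_set_def)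
qed

lemma partitional_pool_messages:
  fixes h :: "'m::finite \<Rightarrow> 'n::finite"
  assumes sig: "stochastic sig" and "\<And>w k l. \<lbrakk>sig w k > 0; sig w l > 0\<rbrakk> \<Longrightarrow> h k = h l"
  shows "partitional (pool_messages h sig)"
  unfolding partitional_def
proof
  fix w
  obtain k where k: "sig w k > 0"
    using stochastic_ex_pos[OF sig] by blast
  have "pool_messages h sig w (h k) = (\<Sum>l\<in>UNIV. sig w l * of_bool (h l = h k))"
    by (simp add: pool_messages_def)
  also have "\<dots> = 1"
    using assms(2)[OF _ k] by (intro stochastic_sum_const_on_support[OF sig]) simp
  finally show "\<exists>m. pool_messages h sig w m = 1"
    by blast
qed

lemma S_BR_pure_imp_response_eq:
  assumes prior: "is_prior mu0" and sig: "stochastic sig" and rho: "stochastic rho"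
    and sbr: "S_BR mu0 uS sig rho"
    and pure: "\<And>m a b. \<lbrakk>m \<in> used_messages sig; rho m a > 0; rho m b > 0\<rbrakk> \<Longrightarrow> a = b"
    and inj: "inj (\<lambda>a. uS a w)"
    and pos: "sig w k > 0" "sig w l > 0"
  shows "rho k = rho l"
proof -
  obtain f where f: "rho m (f m) > 0" for m
    using stochastic_ex_pos[OF rho] by metis
  have used: "k \<in> used_messages sig" "l \<in> used_messages sig"
    using pos by (auto simp: used_messages_def)
  have rho_eq: "rho m = pure_strategy f m" if "m \<in> used_messages sig" for m
    using pure[OF that _ f] by (intro stochastic_eq_pure_strategy[OF rho])
  have "msg_value uS rho w k = msg_value uS rho w l"
    using sbr pos by (intro argmax_set_eq_value) (simp_all add: S_BR_iff[OF prior sig])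
  then have "uS (f k) w = uS (f l) w"
    using used by (simp add: msg_value_def rho_eq)
  then have "f k = f l"
    using injD[OF inj] by blast
  then show ?thesis
    using used by (simp add: rho_eq pure_strategy_def fun_eq_iff)
qed

lemma pure_cheap_talk_imp_partitional:
  fixes sig :: "'w::finite \<Rightarrow> 'm::finite \<Rightarrow> real"
  assumes prior: "is_prior mu0" and eq: "cheap_talk_eq mu0 uS uR sig rho"
    and pure: "\<And>m a b. \<lbrakk>m \<in> used_messages sig; rho m a > 0; rho m b > 0\<rbrakk> \<Longrightarrow> a = b"
    and inj: "\<And>w. inj (\<lambda>a. uS a w)"
  obtains sig' :: "'w \<Rightarrow> 'm \<Rightarrow> real"
  where "persuasion_profile mu0 uR sig' rho" "partitional sig'"
    "payoff mu0 uS sig' rho = payoff mu0 uS sig rho"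
proof
  have prof: "persuasion_profile mu0 uR sig rho" and sbr: "S_BR mu0 uS sig rho"
    using eq by (simp_all add: cheap_talk_eq_iff)
  then have sig: "stochastic sig" and rho: "stochastic rho"
    by (simp_all add: persuasion_profile_iff)
  have rho_inv: "rho \<circ> (inv rho \<circ> rho) = rho"
    by (simp add: fun_eq_iff f_inv_into_f[OF rangeI])
  let ?sig' = "pool_messages (inv rho \<circ> rho) sig"
  show "persuasion_profile mu0 uR ?sig' rho"
    by (rule persuasion_profile_pool_messages[OF prof rho_inv])
  have "(inv rho \<circ> rho) k = (inv rho \<circ> rho) l" if "sig w k > 0" "sig w l > 0" for w k l
    using S_BR_pure_imp_response_eq[OF prior sig rho sbr pure inj that] by simp
  then show "partitional ?sig'"
    by (rule partitional_pool_messages[OF sig])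
  show "payoff mu0 uS ?sig' rho = payoff mu0 uS sig rho"
    by (simp only: payoff_pool_messages rho_inv)
qed

lemma commitment_not_valuable_imp_randomization_not_valued:
  fixes uS uR :: "'a::finite \<Rightarrow> 'w::finite \<Rightarrow> real"
  assumes prior: "is_prior mu0" and inj: "\<And>w. inj (\<lambda>a. uS a w)"
    and unique: "unique_optimal_outcome mu0 uS uR TYPE('m::finite)"
    and not_valuable: "\<not> commitment_valuable mu0 uS uR TYPE('m)"
  shows "\<not> values_randomization mu0 uS uR TYPE('m)"
proof -
  obtain sig :: "'w \<Rightarrow> 'm \<Rightarrow> real" and rho where
    eq: "cheap_talk_eq mu0 uS uR sig rho" and
    payoff: "payoff mu0 uS sig rho = cheap_talk_payoff mu0 uS uR TYPE('m)"
    using cheap_talk_payoff_attained[OF prior] .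
  have opt: "optimal_persuasion_profile mu0 uS uR sig rho"
    using eq payoff not_valuable
    by (simp add: cheap_talk_eq_iff commitment_valuable_def optimal_persuasion_profile_iff)
  obtain sig' :: "'w \<Rightarrow> 'm \<Rightarrow> real" where
    "persuasion_profile mu0 uR sig' rho" "partitional sig'"
    and payoff': "payoff mu0 uS sig' rho = payoff mu0 uS sig rho"
    using pure_cheap_talk_imp_partitional[OF prior eq
        optimal_imp_pure_response[OF prior unique opt] inj] .
  then have "payoff mu0 uS sig' rho \<le> partitional_persuasion_payoff mu0 uS uR TYPE('m)"
    by (intro payoff_le_partitional_persuasion_payoff)
  then show ?thesis
    using opt payoff' by (simp add: values_randomization_def optimal_persuasion_profile_def)
qed

lemma randomization_not_valued_imp_unique_best_responses:
  assumes prior: "is_prior mu0" and never_indifferent: "never_indifferent mu0 uR"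
    and not_valued: "\<not> values_randomization mu0 uS uR TYPE('m)"
  obtains sig :: "'w::finite \<Rightarrow> 'm::finite \<Rightarrow> real" and rho
  where "optimal_persuasion_profile mu0 uS uR sig rho" "unique_best_responses mu0 uR sig"
proof -
  obtain sig :: "'w \<Rightarrow> 'm \<Rightarrow> real" and rho where
    prof: "persuasion_profile mu0 uR sig rho" and "partitional sig" and
    payoff: "payoff mu0 uS sig rho = partitional_persuasion_payoff mu0 uS uR TYPE('m)"
    using partitional_persuasion_payoff_attained[OF prior] .
  then have "unique_best_responses mu0 uR sig"
    using never_indifferent by (simp add: partitional_imp_unique_best_responses persuasion_profile_iff)
  moreover have "optimal_persuasion_profile mu0 uS uR sig rho"
    using prof payoff not_valued by (simp add: values_randomization_def optimal_persuasion_profile_iff)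
  ultimately show ?thesis
    using that by blast
qed

lemma commitment_randomization_indifference_equivalences:
  fixes uS uR :: "'a::finite \<Rightarrow> 'w::finite \<Rightarrow> real"
  assumes prior: "is_prior mu0" and inj: "\<And>w. inj (\<lambda>a. uS a w)"
    and never_indifferent: "never_indifferent mu0 uR"
    and unique: "unique_optimal_outcome mu0 uS uR TYPE('m::finite)"
  shows "commitment_valuable mu0 uS uR TYPE('m) \<longleftrightarrow> values_randomization mu0 uS uR TYPE('m)"
    and "values_randomization mu0 uS uR TYPE('m) \<longleftrightarrow>
      (\<forall>(sig :: 'w \<Rightarrow> 'm \<Rightarrow> real) rho. optimal_persuasion_profile mu0 uS uR sig rho \<longrightarrow>
        (\<exists>m\<in>used_messages sig.
          card (argmax_set (\<lambda>a. \<Sum>w\<in>UNIV. posterior mu0 sig m w * uR a w)) \<ge> 2))"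
proof -
  let ?indifferent = "\<forall>(sig :: 'w \<Rightarrow> 'm \<Rightarrow> real) rho. optimal_persuasion_profile mu0 uS uR sig rho \<longrightarrow>
    (\<exists>m\<in>used_messages sig. card (argmax_set (\<lambda>a. \<Sum>w\<in>UNIV. posterior mu0 sig m w * uR a w)) \<ge> 2)"
  have indifferent_iff: "?indifferent \<longleftrightarrow> (\<forall>(sig :: 'w \<Rightarrow> 'm \<Rightarrow> real) rho.
      optimal_persuasion_profile mu0 uS uR sig rho \<longrightarrow> \<not> unique_best_responses mu0 uR sig)"
  proof (intro iff_allI imp_cong refl)
    fix sig :: "'w \<Rightarrow> 'm \<Rightarrow> real" and rho
    assume "optimal_persuasion_profile mu0 uS uR sig rho"
    then have "stochastic sig"
      by (simp add: optimal_persuasion_profile_def persuasion_profile_iff)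
    then show "(\<exists>m\<in>used_messages sig.
          card (argmax_set (\<lambda>a. \<Sum>w\<in>UNIV. posterior mu0 sig m w * uR a w)) \<ge> 2)
        \<longleftrightarrow> \<not> unique_best_responses mu0 uR sig"
      by (simp add: unique_best_responses_iff_card_argmax_posterior[OF prior])
  qed
  have "commitment_valuable mu0 uS uR TYPE('m)" if "values_randomization mu0 uS uR TYPE('m)"
    using commitment_not_valuable_imp_randomization_not_valued[OF prior inj unique] that by blast
  moreover have "?indifferent" if "commitment_valuable mu0 uS uR TYPE('m)"
    unfolding indifferent_iff
    using unique_best_responses_imp_not_commitment_valuable[OF prior] that by blast
  moreover have "values_randomization mu0 uS uR TYPE('m)" if "?indifferent"
    using randomization_not_valued_imp_unique_best_responses[OF prior never_indifferent] that
    unfolding indifferent_iff by metis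
  ultimately show "commitment_valuable mu0 uS uR TYPE('m) \<longleftrightarrow> values_randomization mu0 uS uR TYPE('m)"
    and "values_randomization mu0 uS uR TYPE('m) \<longleftrightarrow> ?indifferent"
    by blast+
qed

section \<open>Genericity\<close>

lemma continuous_on_envs [continuous_intros]:
  assumes "continuous_on S e"
  shows "continuous_on S (\<lambda>x. envS (e x))" "continuous_on S (\<lambda>x. envR (e x))"
  unfolding envS_def envR_def
  by (intro continuous_on_coordinatewise_then_product
      continuous_on_product_then_coordinatewise[OF assms])+

lemma continuous_on_outcome [continuous_intros]:
  assumes "continuous_on S sig" "continuous_on S rho"
  shows "continuous_on S (\<lambda>x. outcome mu0 (sig x) (rho x) a w)"
  unfolding outcome_def
  by (intro continuous_intros assms[THEN continuous_on_apply2])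

lemma closed_payoff_hypograph:
  fixes C :: "(('w::finite \<Rightarrow> 'm::finite \<Rightarrow> real) \<times> ('m \<Rightarrow> 'a::finite \<Rightarrow> real)) set"
  assumes C: "closed C"
  shows "closed {(e, c). \<exists>z\<in>C. persuasion_profile mu0 (envR e) (fst z) (snd z) \<and>
    c \<le> payoff mu0 (envS e) (fst z) (snd z)}" (is "closed ?H")
proof -
  let ?T = "{p. fst p \<in> C \<and> persuasion_profile mu0 (envR (fst (snd p))) (fst (fst p)) (snd (fst p)) \<and>
    snd (snd p) \<le> payoff mu0 (envS (fst (snd p))) (fst (fst p)) (snd (fst p))}"
  have "closed {p :: (('w \<Rightarrow> 'm \<Rightarrow> real) \<times> ('m \<Rightarrow> 'a \<Rightarrow> real)) \<times> ((bool \<times> 'a \<times> 'w \<Rightarrow> real) \<times> real).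
      fst p \<in> C}"
    using closed_vimage_fst[OF C] by (simp add: vimage_def)
  then have "closed {y. \<exists>z\<in>{sig. stochastic sig} \<times> {rho. stochastic rho}. (z, y) \<in> ?T}"
    by (intro closed_projection_compact compact_strategy_profiles closed_Collect_conj
        closed_Collect_persuasion_profile closed_Collect_le continuous_intros)
  moreover have "{y. \<exists>z\<in>{sig. stochastic sig} \<times> {rho. stochastic rho}. (z, y) \<in> ?T} = ?H"
    by (auto simp: mem_Times_iff Bex_def persuasion_profile_iff simp del: split_paired_Ex)
  ultimately show ?thesis
    by simp
qed

lemma borel_measurable_persuasion_payoff:
  fixes mu0 :: "'w::finite \<Rightarrow> real"
  assumes "is_prior mu0"
  shows "(\<lambda>e :: bool \<times> 'a::finite \<times> 'w \<Rightarrow> real.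
    persuasion_payoff mu0 (envS e) (envR e) TYPE('m::finite)) \<in> borel_measurable borel"
  unfolding borel_measurable_iff_ge
proof
  fix c :: real
  let ?H = "{(e, c). \<exists>z :: ('w \<Rightarrow> 'm \<Rightarrow> real) \<times> ('m \<Rightarrow> 'a \<Rightarrow> real)\<in>UNIV.
    persuasion_profile mu0 (envR e) (fst z) (snd z) \<and> c \<le> payoff mu0 (envS e) (fst z) (snd z)}"
  have "c \<le> persuasion_payoff mu0 (envS e) (envR e) TYPE('m) \<longleftrightarrow> (e, c) \<in> ?H"
    for e :: "bool \<times> 'a \<times> 'w \<Rightarrow> real"
  proof
    assume "c \<le> persuasion_payoff mu0 (envS e) (envR e) TYPE('m)"
    moreover obtain sig :: "'w \<Rightarrow> 'm \<Rightarrow> real" and rho where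
      "optimal_persuasion_profile mu0 (envS e) (envR e) sig rho"
      using optimal_persuasion_profile_exists[OF assms] .
    ultimately show "(e, c) \<in> ?H"
      by (auto simp: optimal_persuasion_profile_def intro!: exI[of _ sig] exI[of _ rho])
  next
    assume "(e, c) \<in> ?H"
    then show "c \<le> persuasion_payoff mu0 (envS e) (envR e) TYPE('m)"
      by (auto intro: order_trans[OF _ payoff_le_persuasion_payoff])
  qed
  moreover have "closed ((\<lambda>e :: bool \<times> 'a \<times> 'w \<Rightarrow> real. (e, c)) -` ?H)"
    by (intro closed_vimage closed_payoff_hypograph closed_UNIV continuous_intros)
  ultimately show "{e \<in> space (borel :: (bool \<times> 'a \<times> 'w \<Rightarrow> real) measure).
      c \<le> persuasion_payoff mu0 (envS e) (envR e) TYPE('m)} \<in> sets borel"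
    by (simp add: vimage_def)
qed

lemma sets_borel_optimal_in_closed:
  fixes mu0 :: "'w::finite \<Rightarrow> real"
    and C :: "(('w \<Rightarrow> 'm::finite \<Rightarrow> real) \<times> ('m \<Rightarrow> 'a::finite \<Rightarrow> real)) set"
  assumes "is_prior mu0" "closed C"
  shows "{e. \<exists>z\<in>C. optimal_persuasion_profile mu0 (envS e) (envR e) (fst z) (snd z)} \<in> sets borel"
proof -
  let ?H = "{(e, c). \<exists>z\<in>C. persuasion_profile mu0 (envR e) (fst z) (snd z) \<and>
    c \<le> payoff mu0 (envS e) (fst z) (snd z)}"
  let ?graph = "\<lambda>e. (e, persuasion_payoff mu0 (envS e) (envR e) TYPE('m))"
  have "?graph \<in> borel_measurable borel"
    by (intro borel_measurable_Pair borel_measurable_persuasion_payoff assms(1)) simp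
  moreover have "?H \<in> sets borel"
    using closed_payoff_hypograph[OF assms(2)] by (rule borel_closed)
  ultimately have "?graph -` ?H \<inter> space borel \<in> sets borel"
    by (rule measurable_sets)
  then show ?thesis
    by (simp add: vimage_def optimal_persuasion_profile_iff)
qed

lemma optimal_outcome_mono:
  fixes sig1 sig2 :: "'w::finite \<Rightarrow> 'm::finite \<Rightarrow> real"
  assumes "s < t"
    and opt1: "optimal_persuasion_profile mu0 (uS(a := (uS a)(w := s))) uR sig1 rho1"
    and opt2: "optimal_persuasion_profile mu0 (uS(a := (uS a)(w := t))) uR sig2 rho2"
  shows "outcome mu0 sig1 rho1 a w \<le> outcome mu0 sig2 rho2 a w"
proof -
  have "payoff mu0 (uS(a := (uS a)(w := s))) sig2 rho2 \<le> payoff mu0 (uS(a := (uS a)(w := s))) sig1 rho1"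
    and "payoff mu0 (uS(a := (uS a)(w := t))) sig1 rho1 \<le> payoff mu0 (uS(a := (uS a)(w := t))) sig2 rho2"
    using opt1 opt2 payoff_le_persuasion_payoff by (metis optimal_persuasion_profile_def)+
  then have "(t - s) * outcome mu0 sig1 rho1 a w \<le> (t - s) * outcome mu0 sig2 rho2 a w"
    unfolding payoff_fun_upd by (simp add: algebra_simps)
  then show ?thesis
    using \<open>s < t\<close> by simp
qed

lemma AE_unique_optimal_outcome:
  fixes mu0 :: "'w::finite \<Rightarrow> real"
  assumes prior: "is_prior mu0"
  shows "AE e in (env_lebesgue :: (bool \<times> 'a::finite \<times> 'w \<Rightarrow> real) measure).
    unique_optimal_outcome mu0 (envS e) (envR e) TYPE('m::finite)"
proof -
  define outcomes where "outcomes a w e = {outcome mu0 sig rho a w | (sig :: 'w \<Rightarrow> 'm \<Rightarrow> real) rho.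
    optimal_persuasion_profile mu0 (envS e) (envR e) sig rho}" for a w and e :: "bool \<times> 'a \<times> 'w \<Rightarrow> real"
  have "AE e in env_lebesgue. \<forall>v\<in>outcomes a w e. \<forall>v'\<in>outcomes a w e. v = v'" for a w
  proof (rule AE_PiM_lborel_monotone_single_valued[of _ "(True, a, w)"])
    fix D :: "real set" assume "closed D"
    have "{e. outcomes a w e \<inter> D \<noteq> {}} = {e. \<exists>z\<in>{z. outcome mu0 (fst z) (snd z) a w \<in> D}.
        optimal_persuasion_profile mu0 (envS e) (envR e) (fst z :: 'w \<Rightarrow> 'm \<Rightarrow> real) (snd z)}"
      by (auto simp: outcomes_def)
    moreover have "closed {z :: ('w \<Rightarrow> 'm \<Rightarrow> real) \<times> ('m \<Rightarrow> 'a \<Rightarrow> real).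
        outcome mu0 (fst z) (snd z) a w \<in> D}"
      using closed_vimage[OF \<open>closed D\<close>, of "\<lambda>z. outcome mu0 (fst z) (snd z) a w"]
      by (simp add: vimage_def continuous_intros)
    ultimately show "{e. outcomes a w e \<inter> D \<noteq> {}} \<in> sets borel"
      by (simp only: sets_borel_optimal_in_closed[OF prior])
  next
    fix e :: "bool \<times> 'a \<times> 'w \<Rightarrow> real" and s t v v'
    have envS: "envS (e((True, a, w) := r)) = (envS e)(a := (envS e a)(w := r))"
      and envR: "envR (e((True, a, w) := r)) = envR e" for r
      by (auto simp: envS_def envR_def fun_eq_iff)
    assume "s < t" "v \<in> outcomes a w (e((True, a, w) := s))"
      "v' \<in> outcomes a w (e((True, a, w) := t))"
    then show "v \<le> v'"
      unfolding outcomes_def envS envR by (auto intro: optimal_outcome_mono)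
  qed
  then have "AE e in env_lebesgue. \<forall>a w. \<forall>v\<in>outcomes a w e. \<forall>v'\<in>outcomes a w e. v = v'"
    by (simp add: AE_all_countable)
  then show ?thesis
  proof eventually_elim
    case (elim e)
    then show ?case
      unfolding unique_optimal_outcome_def fun_eq_iff outcomes_def by blast
  qed
qed

lemma AE_never_indifferent:
  fixes mu0 :: "'w::finite \<Rightarrow> real"
  assumes "\<And>w. mu0 w \<noteq> 0"
  shows "AE e in (env_lebesgue :: (bool \<times> 'a::finite \<times> 'w \<Rightarrow> real) measure).
    never_indifferent mu0 (\<lambda>a w. e (i, a, w))"
proof -
  have "AE e in (env_lebesgue :: (bool \<times> 'a \<times> 'w \<Rightarrow> real) measure).
      (\<Sum>w\<in>T. mu0 w * e (i, a, w)) \<noteq> (\<Sum>w\<in>T. mu0 w * e (i, b, w))" if "v \<in> T" "a \<noteq> b" for T v a b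
  proof (rule AE_PiM_lborel_countable_slices[of _ "(i, a, v)"])
    have "closed {e :: bool \<times> 'a \<times> 'w \<Rightarrow> real.
        (\<Sum>w\<in>T. mu0 w * e (i, a, w)) = (\<Sum>w\<in>T. mu0 w * e (i, b, w))}"
      by (intro closed_Collect_eq continuous_intros continuous_on_product_coordinates)
    then show "{e :: bool \<times> 'a \<times> 'w \<Rightarrow> real.
        \<not> (\<Sum>w\<in>T. mu0 w * e (i, a, w)) \<noteq> (\<Sum>w\<in>T. mu0 w * e (i, b, w))} \<in> sets env_lebesgue"
      by (simp add: sets_PiM_lborel_eq_borel borel_closed)
  next
    fix e :: "bool \<times> 'a \<times> 'w \<Rightarrow> real"
    let ?rest = "\<Sum>w\<in>T - {v}. mu0 w * e (i, a, w)" and ?other = "\<Sum>w\<in>T. mu0 w * e (i, b, w)"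
    have "(\<Sum>w\<in>T. mu0 w * (e((i, a, v) := t)) (i, a, w)) = mu0 v * t + ?rest" for t
      using that(1) by (subst sum.remove[of _ v]) auto
    then have "{t. \<not> (\<Sum>w\<in>T. mu0 w * (e((i, a, v) := t)) (i, a, w)) \<noteq>
        (\<Sum>w\<in>T. mu0 w * (e((i, a, v) := t)) (i, b, w))} = {(?other - ?rest) / mu0 v}"
      using that(2) assms[of v] by (auto simp: field_simps)
    then show "countable {t. \<not> (\<Sum>w\<in>T. mu0 w * (e((i, a, v) := t)) (i, a, w)) \<noteq>
        (\<Sum>w\<in>T. mu0 w * (e((i, a, v) := t)) (i, b, w))}"
      by simp
  qed
  then show ?thesis
    unfolding never_indifferent_def AE_all_countable by (auto simp: ex_in_conv[symmetric])
qed

lemma never_indifferent_imp_inj: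
  assumes "never_indifferent mu0 u"
  shows "inj (\<lambda>a. u a w)"
proof (rule injI, rule ccontr)
  fix a b assume "u a w = u b w" "a \<noteq> b"
  then show False
    using assms[unfolded never_indifferent_def, rule_format, of "{w}" a b] by simp
qed

lemma env_cube_eq_PiE: "env_cube = (\<Pi>\<^sub>E i\<in>UNIV. {0..1})"
  by (auto simp: env_cube_def)

lemma sets_env_cube: "env_cube \<in> sets env_lebesgue"
  unfolding env_cube_eq_PiE by (intro sets_PiM_I_finite) auto

lemma emeasure_env_cube:
  "emeasure (env_lebesgue :: (bool \<times> 'a::finite \<times> 'w::finite \<Rightarrow> real) measure) env_cube = 1"
proof -
  interpret product_sigma_finite "\<lambda>_ :: bool \<times> 'a \<times> 'w. lborel :: real measure"
    by unfold_locales
  show ?thesis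
    unfolding env_cube_eq_PiE by (subst emeasure_PiM) auto
qed

lemma AE_imp_full_measure_subset_env_cube:
  fixes P :: "(bool \<times> 'a::finite \<times> 'w::finite \<Rightarrow> real) \<Rightarrow> bool"
  assumes "AE e in env_lebesgue. P e"
  shows "\<exists>E. E \<subseteq> env_cube \<and> E \<in> sets env_lebesgue \<and> emeasure env_lebesgue E = 1 \<and> (\<forall>e\<in>E. P e)"
proof -
  obtain N where N: "N \<in> null_sets env_lebesgue" and P: "{e \<in> space env_lebesgue. \<not> P e} \<subseteq> N"
    using assms unfolding eventually_ae_filter by blast
  have "P e" if "e \<in> env_cube - N" for e
    using P that by (auto simp: space_PiM)
  moreover have "env_cube - N \<in> sets env_lebesgue"
    using N sets_env_cube by blast
  moreover have "emeasure env_lebesgue (env_cube - N) = 1"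
    using emeasure_Diff_null_set[OF N sets_env_cube] by (simp add: emeasure_env_cube)
  ultimately show ?thesis
    by blast
qed

theorem mainTheorem2:
  fixes mu0 :: "'w::finite \<Rightarrow> real"
  assumes "is_prior mu0"
    and "CARD('m::finite) > max CARD('w) CARD('a::finite)"
  shows "\<exists>E :: (bool \<times> 'a \<times> 'w \<Rightarrow> real) set.
           E \<subseteq> env_cube \<and> E \<in> sets env_lebesgue \<and> emeasure env_lebesgue E = 1 \<and>
           (\<forall>e\<in>E.
              (commitment_valuable mu0 (envS e) (envR e) TYPE('m)
                 \<longleftrightarrow> values_randomization mu0 (envS e) (envR e) TYPE('m)) \<and>
              (values_randomization mu0 (envS e) (envR e) TYPE('m)
                 \<longleftrightarrow> (\<forall>(sig :: 'w \<Rightarrow> 'm \<Rightarrow> real) rho.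
                        optimal_persuasion_profile mu0 (envS e) (envR e) sig rho \<longrightarrow>
                        (\<exists>m\<in>used_messages sig.
                           card (argmax_set (\<lambda>a. \<Sum>w\<in>UNIV. posterior mu0 sig m w * envR e a w)) \<ge> 2))))"
    (is "\<exists>E. E \<subseteq> env_cube \<and> E \<in> sets env_lebesgue \<and> emeasure env_lebesgue E = 1 \<and> (\<forall>e\<in>E. ?P e)")
proof -
  have mu0_nonzero: "mu0 w \<noteq> 0" for w
    using assms(1) by (auto simp: is_prior_def less_le)
  have "AE e in env_lebesgue. ?P e"
    using AE_unique_optimal_outcome[OF assms(1), where 'm = 'm and 'a = 'a]
      AE_never_indifferent[of mu0 True, OF mu0_nonzero]
      AE_never_indifferent[of mu0 False, OF mu0_nonzero]
  proof eventually_elim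
    case (elim e)
    have "inj (\<lambda>a. envS e a w)" for w
      using never_indifferent_imp_inj[OF elim(2)] by (simp add: envS_def)
    moreover have "never_indifferent mu0 (envR e)"
      using elim(3) by (simp add: envR_def[abs_def])
    ultimately show ?case
      using commitment_randomization_indifference_equivalences[OF assms(1) _ _ elim(1)]
      by blast
  qed
  then show ?thesis
    by (rule AE_imp_full_measure_subset_env_cube)
qed

end
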